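(* Let $n=2^{k_1}+2^{k_2}+\cdots+2^{k_l}$, where $k_i\ge 0$ and $k_i<k_{i-1}$ (so $k_1>k_2>\cdots>k_l\ge 0$). Then the Sylow 2-subgroup of $S_n$ is isomorphic to $$\mathrm{Syl}_2(S_{2^{k_1}})\times \mathrm{Syl}_2(S_{2^{k_2}})\times\cdots\times \mathrm{Syl}_2(S_{2^{k_l}}).$$ The Sylow 2-subgroup $\mathrm{Syl}_2(A_n)$ has index $2$ in $\mathrm{Syl}_2(S_n)$, and its structure is $$\mathrm{Syl}_2(S_{2^{k_1}})\boxtimes \mathrm{Syl}_2(S_{2^{k_2}})\boxtimes\cdots\boxtimes \mathrm{Syl}_2(S_{2^{k_l}}).$$
   Context: $S_n$ and $A_n$ are the symmetric and alternating groups of degree $n$, and $\mathrm{Syl}_2(G)$ denotes a Sylow 2-subgroup of the finite group $G$. The direct product $\mathrm{Syl}_2(S_{2^{k_1}})\times\cdots\times\mathrm{Syl}_2(S_{2^{k_l}})$ is regarded as a permutation group of degree $n$, the $i$-th factor acting on the $i$-th block of a partition of $\{1,\ldots,n\}$ into blocks of sizes $2^{k_1},\ldots,2^{k_l}$. The operation $\boxtimes$ (a subdirect product, taken as an $l$-ary, non-associative operation) is defined by $$\mathrm{Syl}_2(S_{2^{k_1}})\boxtimes\cdots\boxtimes \mathrm{Syl}_2(S_{2^{k_l}})=\mathrm{Par}\bigl(\mathrm{Syl}_2(S_{2^{k_1}})\times\cdots\times \mathrm{Syl}_2(S_{2^{k_l}})\bigr),$$ where $\mathrm{Par}(G)$ is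 the set of all even permutations in the permutation group $G$.
   Formalization: The claim that Syl_2(A_n) has index 2 in Syl_2(S_n) is proved only for n ≥ 2; for n = 1 (l = 1, k_1 = 0) both groups are trivial and the index is 1. The other claims are proved for all n. *)

theory Defs
  imports "HOL-Algebra.Algebra"
begin

definition sylow_subgroup :: "nat \<Rightarrow> ('a, 'b) monoid_scheme \<Rightarrow> 'a set \<Rightarrow> bool"
  where "sylow_subgroup p G H \<longleftrightarrow> subgroup H G \<and> card H = p ^ multiplicity p (order G)"

text \<open>A partition of \<open>{1..n}\<close> into blocks of sizes \<open>d 1, \<dots>, d l\<close>, each block coming with an
  identification with \<open>{1..d i}\<close>: the \<open>i\<close>-th block is \<open>\<phi> i ` {1..d i}\<close>.\<close>

definition block_labelling :: "nat \<Rightarrow> nat \<Rightarrow> (nat \<Rightarrow> nat) \<Rightarrow> (nat \<Rightarrow> nat \<Rightarrow> nat) \<Rightarrow> bool"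
  where "block_labelling n l d \<phi> \<longleftrightarrow>
    bij_betw (\<lambda>(i, x). \<phi> i x) (SIGMA i:{1..l}. {1..d i}) {1..n}"

text \<open>The direct product of permutation groups \<open>Q i\<close> of degree \<open>d i\<close>, regarded as a permutation
  group of degree \<open>n\<close>: the \<open>i\<close>-th component \<open>q i\<close> of a tuple \<open>q\<close> acts on the \<open>i\<close>-th block.\<close>

definition perm_direct_product ::
    "nat \<Rightarrow> nat \<Rightarrow> (nat \<Rightarrow> nat) \<Rightarrow> (nat \<Rightarrow> nat \<Rightarrow> nat) \<Rightarrow> (nat \<Rightarrow> (nat \<Rightarrow> nat) set) \<Rightarrow> (nat \<Rightarrow> nat) set"
  where "perm_direct_product n l d \<phi> Q =
    {p. p permutes {1..n} \<and>
        (\<exists>q \<in> (\<Pi>\<^sub>E i\<in>{1..l}. Q i). \<forall>i\<in>{1..l}. \<forall>x\<in>{1..d i}. p (\<phi> i x) = \<phi> i (q i x))}"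

definition Par :: "(nat \<Rightarrow> nat) set \<Rightarrow> (nat \<Rightarrow> nat) set"
  where "Par H = {p \<in> H. evenperm p}"

definition boxtimes ::
    "nat \<Rightarrow> nat \<Rightarrow> (nat \<Rightarrow> nat) \<Rightarrow> (nat \<Rightarrow> nat \<Rightarrow> nat) \<Rightarrow> (nat \<Rightarrow> (nat \<Rightarrow> nat) set) \<Rightarrow> (nat \<Rightarrow> nat) monoid"
  where "boxtimes n l d \<phi> Q = sym_group n\<lparr>carrier := Par (perm_direct_product n l d \<phi> Q)\<rparr>"

end

theory Submission
  imports Defs
begin

text \<open>
  For \<open>m < 2\<^sup>a\<close> the numbers \<open>2\<^sup>a + j\<close> and \<open>j\<close>, \<open>0 < j \<le> m\<close>, have the same 2-adic
  valuation, so the valuation of \<open>n!\<close> is the sum of those of the \<open>(2 ^ k i)!\<close>. By order, the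
  direct product of the \<open>Q i\<close> acting on the blocks is therefore itself a Sylow 2-subgroup of
  \<open>S\<^sub>n\<close>, and \<open>P\<close> is conjugate to it. For \<open>n \<ge> 2\<close> a Sylow 2-subgroup of \<open>S\<^sub>n\<close> is too large
  to lie in \<open>A\<^sub>n\<close>, so it contains an odd permutation and its even part, of index 2, has the
  order of a Sylow 2-subgroup of \<open>A\<^sub>n\<close>. Conjugacy of Sylow subgroups comes from counting the
  fixed points of a \<open>p\<close>-subgroup acting on the cosets of a Sylow subgroup.
\<close>

section \<open>Sylow's second theorem\<close>

text \<open>Orbit lengths add up to \<open>card E\<close>, so one of them is not divisible by
  \<open>p\<close>. It divides \<open>p ^ a\<close> by the orbit-stabilizer theorem, hence is 1, and
  its orbit is a fixed point.\<close>

lemma (in group_action) p_group_fixed_point: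
  assumes "finite E" "Factorial_Ring.prime p" "order G = p ^ a" "\<not> p dvd card E"
  shows "\<exists>x\<in>E. \<forall>g\<in>carrier G. \<phi> g x = x"
proof -
  have sum_orbits: "(\<Sum>orb\<in>orbits G E \<phi>. card orb) = card E"
    using disjoint_sum[OF assms(1), of "\<lambda>_. 1::nat"] by simp
  have "\<exists>orb\<in>orbits G E \<phi>. \<not> p dvd card orb"
    using assms(4) dvd_sum[of "orbits G E \<phi>" p card] unfolding sum_orbits by blast
  then obtain x where x: "x \<in> E" "\<not> p dvd card (orbit G \<phi> x)"
    unfolding orbits_def by auto
  have "card (orbit G \<phi> x) dvd p ^ a"
    using orbit_stabilizer_theorem[OF x(1)] assms(3) by (metis dvd_triv_left)
  then obtain b where "card (orbit G \<phi> x) = p ^ b"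
    using divides_primepow_nat[OF assms(2)] by auto
  with x(2) have "card (orbit G \<phi> x) = 1"
    by (cases b) auto
  then obtain y where "orbit G \<phi> x = {y}"
    by (auto simp: card_1_singleton_iff)
  with orbit_refl[OF x(1)] have "orbit G \<phi> x = {x}"
    by auto
  then have "\<forall>g\<in>carrier G. \<phi> g x = x"
    unfolding orbit_def by auto
  with x(1) show ?thesis by blast
qed

text \<open>Right multiplication reverses the order of products, and the inverse turns it into a
  left action. The maps are restricted to the cosets because \<open>Bij\<close> consists of
  extensional functions.\<close>

lemma (in group) action_on_rcosets:
  assumes K: "subgroup K G"
  shows "group_action G (rcosets K) (\<lambda>g. \<lambda>C\<in>rcosets K. C #> inv g)"
proof -
  let ?\<phi> = "\<lambda>g. \<lambda>C\<in>rcosets K. C #> inv g"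
  have sub: "C \<subseteq> carrier G" if "C \<in> rcosets K" for C
    using that K rcosets_part_G by blast
  have closed: "C #> g \<in> rcosets K" if C: "C \<in> rcosets K" and g: "g \<in> carrier G" for C g
  proof -
    obtain x where x: "x \<in> carrier G" "C = K #> x"
      using C by (auto simp: RCOSETS_def)
    have "C #> g = K #> (x \<otimes> g)"
      using x g K by (simp add: coset_mult_assoc subgroup.subset)
    then show ?thesis
      using x g K by (simp add: rcosetsI subgroup.subset)
  qed
  have bij: "?\<phi> g \<in> Bij (rcosets K)" if g: "g \<in> carrier G" for g
    unfolding Bij_def
  proof
    show "?\<phi> g \<in> {f. bij_betw f (rcosets K) (rcosets K)}"
      using g
      by (intro CollectI bij_betw_byWitness[where f' = "\<lambda>C. C #> g"])
        (auto simp: closed coset_mult_assoc sub coset_mult_one)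
  qed simp
  have "?\<phi> \<in> hom G (BijGroup (rcosets K))"
  proof (rule homI)
    fix g h assume g: "g \<in> carrier G" and h: "h \<in> carrier G"
    show "?\<phi> (g \<otimes> h) = ?\<phi> g \<otimes>\<^bsub>BijGroup (rcosets K)\<^esub> ?\<phi> h"
      using g h bij
      by (auto simp: BijGroup_def compose_def fun_eq_iff closed coset_mult_assoc sub inv_mult_group)
  qed (simp add: BijGroup_def bij)
  then show ?thesis
    by (simp add: group_action_def group_hom_def group_hom_axioms_def group_BijGroup is_group)
qed

text \<open>Let \<open>H\<close> act on the right cosets of \<open>K\<close>. Their number is prime
  to \<open>p\<close>, so some coset \<open>K #> g\<close> is fixed by all of \<open>H\<close>, and
  \<open>K #> (g \<otimes> h) = K #> g\<close> says that the conjugate of \<open>h\<close> by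
  \<open>g\<close> lies in \<open>K\<close>.\<close>

lemma (in group) p_subgroup_conjugate_into:
  assumes fin: "finite (carrier G)" and p: "Factorial_Ring.prime p"
    and H: "subgroup H G" "card H = p ^ a"
    and K: "subgroup K G" "\<not> p dvd card (rcosets K)"
  shows "\<exists>g\<in>carrier G. \<forall>h\<in>H. g \<otimes> h \<otimes> inv g \<in> K"
proof -
  let ?\<phi> = "\<lambda>g. \<lambda>C\<in>rcosets K. C #> inv g"
  interpret group_action "G\<lparr>carrier := H\<rparr>" "rcosets K" ?\<phi>
    using group_action.induced_action[OF action_on_rcosets[OF K(1)] H(1)] .
  have "finite (rcosets K)"
    using fin rcosets_part_G[OF K(1)] by (metis finite_UnionD)
  then obtain C where C: "C \<in> rcosets K" "\<forall>h\<in>H. ?\<phi> h C = C"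
    using p_group_fixed_point[OF _ p _ K(2), of a] H(2) by (auto simp: order_def)
  then obtain g where g: "g \<in> carrier G" "C = K #> g"
    by (auto simp: RCOSETS_def)
  have "g \<otimes> h \<otimes> inv g \<in> K" if h: "h \<in> H" for h
  proof -
    have hG: "h \<in> carrier G"
      using h H(1) by (meson subgroup.mem_carrier)
    \<comment> \<open>The action multiplies by inverses, so fixedness is applied to the inverse of
      \<open>h\<close>.\<close>
    have "K #> (g \<otimes> h) = K #> g"
      using C(2) subgroup.m_inv_closed[OF H(1) h] C(1) g hG K(1)
      by (metis coset_mult_assoc inv_inv restrict_apply' subgroup.subset)
    then have "K #> (g \<otimes> h \<otimes> inv g) = K"
      using coset_mult_inv2 [of K "g \<otimes> h" g] g hG K(1) by (simp add: subgroup.subset)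
    then show ?thesis
      using coset_join1 g hG K(1) by auto
  qed
  with g(1) show ?thesis by blast
qed

lemma (in group) conjugation_hom:
  assumes "g \<in> carrier G"
  shows "(\<lambda>h. g \<otimes> h \<otimes> inv g) \<in> hom G G"
proof (rule homI)
  fix x y assume "x \<in> carrier G" "y \<in> carrier G"
  with assms show "g \<otimes> (x \<otimes> y) \<otimes> inv g = g \<otimes> x \<otimes> inv g \<otimes> (g \<otimes> y \<otimes> inv g)"
    by (simp add: m_assoc) (simp flip: m_assoc)
qed (use assms in simp)

lemma (in group) conjugate_subgroup:
  assumes g: "g \<in> carrier G" and H: "subgroup H G"
  shows "subgroup ((\<lambda>h. g \<otimes> h \<otimes> inv g) ` H) G"
    and "card ((\<lambda>h. g \<otimes> h \<otimes> inv g) ` H) = card H"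
proof -
  interpret conj: group_hom G G "\<lambda>h. g \<otimes> h \<otimes> inv g"
    by unfold_locales (rule conjugation_hom[OF g])
  show "subgroup ((\<lambda>h. g \<otimes> h \<otimes> inv g) ` H) G"
    using H by (rule conj.subgroup_img_is_subgroup)
  have "inj_on (\<lambda>h. g \<otimes> h \<otimes> inv g) H"
    using g subgroup.mem_carrier[OF H] by (intro inj_onI) (meson conjugation_is_inj)
  then show "card ((\<lambda>h. g \<otimes> h \<otimes> inv g) ` H) = card H"
    by (rule card_image)
qed

lemma (in group) sylow_subgroup_index:
  assumes "finite (carrier G)" "Factorial_Ring.prime p" "sylow_subgroup p G K"
  shows "\<not> p dvd card (rcosets K)"
proof
  assume "p dvd card (rcosets K)"
  moreover have "card (rcosets K) * p ^ multiplicity p (order G) = order G"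
    using lagrange[of K] assms(3) by (simp add: sylow_subgroup_def)
  ultimately have "p ^ Suc (multiplicity p (order G)) dvd order G"
    by (metis mult_dvd_mono dvd_refl power_Suc)
  moreover have "order G > 0"
    using assms(1) by (simp add: order_gt_0_iff_finite)
  ultimately show False
    using assms(2) multiplicity_geI[of "order G" p "Suc (multiplicity p (order G))"]
      prime_gt_1_nat[OF assms(2)]
    by auto
qed

text \<open>Once \<open>H\<close> is conjugated into \<open>K\<close>, the inverse conjugation
  carries \<open>K\<close> to a Sylow subgroup around \<open>H\<close>. This later places a Sylow
  2-subgroup of the alternating group inside one of the symmetric group.\<close>

lemma (in group) p_subgroup_in_sylow:
  assumes fin: "finite (carrier G)" and p: "Factorial_Ring.prime p"
    and H: "subgroup H G" "card H = p ^ a" and K: "sylow_subgroup p G K"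
  shows "\<exists>K'. sylow_subgroup p G K' \<and> H \<subseteq> K'"
proof -
  have KG: "subgroup K G"
    using K by (simp add: sylow_subgroup_def)
  obtain g where g: "g \<in> carrier G" "\<forall>h\<in>H. g \<otimes> h \<otimes> inv g \<in> K"
    using p_subgroup_conjugate_into[OF fin p H KG sylow_subgroup_index[OF fin p K]] by blast
  let ?K' = "(\<lambda>h. inv g \<otimes> h \<otimes> inv (inv g)) ` K"
  have "sylow_subgroup p G ?K'"
    using K conjugate_subgroup[OF inv_closed[OF g(1)] KG] by (simp add: sylow_subgroup_def)
  moreover have "H \<subseteq> ?K'"
  proof
    fix h assume h: "h \<in> H"
    then have "h \<in> carrier G"
      using H(1) by (meson subgroup.mem_carrier)
    then have "h = inv g \<otimes> (g \<otimes> h \<otimes> inv g) \<otimes> inv (inv g)"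
      using conjugation_is_surj[of "inv g" h] g(1) by simp
    with g(2) h show "h \<in> ?K'" by blast
  qed
  ultimately show ?thesis by blast
qed

lemma (in group) sylow_subgroups_iso:
  assumes fin: "finite (carrier G)" and p: "Factorial_Ring.prime p"
    and H: "sylow_subgroup p G H" and K: "sylow_subgroup p G K"
  shows "G\<lparr>carrier := H\<rparr> \<cong> G\<lparr>carrier := K\<rparr>"
proof -
  have HG: "subgroup H G" "card H = p ^ multiplicity p (order G)" and KG: "subgroup K G"
    and cards: "card H = card K"
    using H K by (auto simp: sylow_subgroup_def)
  obtain g where g: "g \<in> carrier G" "\<forall>h\<in>H. g \<otimes> h \<otimes> inv g \<in> K"
    using p_subgroup_conjugate_into[OF fin p HG KG sylow_subgroup_index[OF fin p K]] by blast
  let ?c = "\<lambda>h. g \<otimes> h \<otimes> inv g"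
  \<comment> \<open>The conjugate of \<open>H\<close> lies in \<open>K\<close> and has the same
    finite cardinality, so it is all of \<open>K\<close>.\<close>
  have "?c ` H = K"
  proof (rule card_subset_eq)
    show "finite K"
      using fin KG by (meson finite_subset subgroup.subset)
    show "card (?c ` H) = card K"
      using conjugate_subgroup(2)[OF g(1) HG(1)] cards by simp
  qed (use g(2) in blast)
  moreover have "inj_on ?c H"
    using g(1) subgroup.mem_carrier[OF HG(1)] by (intro inj_onI) (meson conjugation_is_inj)
  moreover have "?c (x \<otimes> y) = ?c x \<otimes> ?c y" if "x \<in> H" "y \<in> H" for x y
    using hom_mult[OF conjugation_hom[OF g(1)]] that subgroup.mem_carrier[OF HG(1)] by blast
  ultimately have "?c \<in> iso (G\<lparr>carrier := H\<rparr>) (G\<lparr>carrier := K\<rparr>)"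
    using g(2) by (auto simp: iso_def hom_def bij_betw_def)
  then show ?thesis by (rule is_isoI)
qed

section \<open>The 2-adic valuation of factorials\<close>

text \<open>As \<open>0 < j < p ^ a\<close>, the valuation \<open>v\<close> of \<open>j\<close> is
  below \<open>a\<close>. Thus \<open>p ^ Suc v\<close> divides \<open>p ^ a\<close>, and adding
  \<open>p ^ a\<close> does not affect whether \<open>p ^ v\<close> or \<open>p ^ Suc v\<close>
  divides.\<close>

lemma multiplicity_add_less:
  fixes p :: nat
  assumes p: "Factorial_Ring.prime p" and "0 < j" "j < p ^ a"
  shows "multiplicity p (p ^ a + j) = multiplicity p j"
proof (rule antisym)
  have less: "multiplicity p j < a"
  proof (rule ccontr)
    assume "\<not> multiplicity p j < a"
    then have "p ^ a dvd j"
      using multiplicity_dvd' linorder_not_less by blast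
    with assms show False by (auto dest: dvd_imp_le)
  qed
  show "multiplicity p j \<le> multiplicity p (p ^ a + j)"
    using assms less
    by (intro multiplicity_geI) (auto intro!: dvd_add le_imp_power_dvd multiplicity_dvd)
  show "multiplicity p (p ^ a + j) \<le> multiplicity p j"
  proof (rule ccontr)
    assume "\<not> ?thesis"
    then have "p ^ Suc (multiplicity p j) dvd p ^ a + j"
      by (intro multiplicity_dvd') simp
    moreover have "p ^ Suc (multiplicity p j) dvd p ^ a"
      using less by (intro le_imp_power_dvd) simp
    ultimately have "p ^ Suc (multiplicity p j) dvd j"
      using dvd_add_right_iff by blast
    then have "Suc (multiplicity p j) \<le> multiplicity p j"
      using assms by (intro multiplicity_geI) auto
    then show False by simp
  qed
qed

text \<open>Passing from \<open>m\<close> to \<open>Suc m\<close> multiplies the two factorials by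
  \<open>p ^ a + Suc m\<close> and \<open>Suc m\<close>, whose valuations agree.\<close>

lemma multiplicity_fact_add:
  fixes p :: nat
  assumes p: "Factorial_Ring.prime p" and "m < p ^ a"
  shows "multiplicity p (fact (p ^ a + m) :: nat) =
    multiplicity p (fact (p ^ a) :: nat) + multiplicity p (fact m :: nat)"
  using assms(2)
proof (induction m)
  case (Suc m)
  have "multiplicity p (fact (p ^ a + Suc m) :: nat) =
      multiplicity p (p ^ a + Suc m) + multiplicity p (fact (p ^ a + m) :: nat)"
    using p by (subst prime_elem_multiplicity_mult_distrib[symmetric]) auto
  moreover have "multiplicity p (fact (Suc m) :: nat) =
      multiplicity p (Suc m) + multiplicity p (fact m :: nat)"
    using p by (subst prime_elem_multiplicity_mult_distrib[symmetric]) (auto simp del: mult_Suc)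
  ultimately show ?case
    using Suc multiplicity_add_less[OF p _ Suc.prems] by simp
qed simp

lemma multiplicity_fact_sum_powers:
  fixes k :: "nat \<Rightarrow> nat"
  assumes "\<And>i. i \<in> {2..l} \<Longrightarrow> k i < k (i - 1)" "1 \<le> l"
  shows "multiplicity 2 (fact (\<Sum>i = 1..l. 2 ^ k i) :: nat) =
    (\<Sum>i = 1..l. multiplicity 2 (fact (2 ^ k i) :: nat))"
proof -
  \<comment> \<open>The induction runs from \<open>i = l\<close> downwards. The bound on the tail
    sum is carried along because \<open>multiplicity_fact_add\<close> requires what follows
    \<open>2 ^ k i\<close> to be smaller than \<open>2 ^ k i\<close>.\<close>
  have "(\<Sum>j = i..l. 2 ^ k j :: nat) < 2 ^ Suc (k i) \<and>
      multiplicity 2 (fact (\<Sum>j = i..l. 2 ^ k j) :: nat) =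
        (\<Sum>j = i..l. multiplicity 2 (fact (2 ^ k j) :: nat))"
    if "i \<le> l" "1 \<le> i" for i
    using that
  proof (induction i rule: inc_induct)
    case (step i)
    then have "k (Suc i) < k i"
      using assms(1)[of "Suc i"] by auto
    then have "(2::nat) ^ Suc (k (Suc i)) \<le> 2 ^ k i"
      by (intro power_increasing) auto
    with step have *: "(\<Sum>j = Suc i..l. 2 ^ k j :: nat) < 2 ^ k i"
      by auto
    have split: "sum f {i..l} = f i + sum f {Suc i..l}" for f :: "nat \<Rightarrow> nat"
      using step.hyps by (intro sum.atLeast_Suc_atMost) auto
    show ?case
      unfolding split using * step multiplicity_fact_add[OF two_is_prime_nat *] by simp
  qed simp
  from this[of 1] assms(2) show ?thesis by simp
qed

section \<open>Direct products of permutation groups\<close>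

text \<open>The explicit permutation induced by a tuple: \<open>inv_into\<close> decodes a point
  into its block and its position there. Points outside \<open>{1..n}\<close> are fixed, as
  \<open>permutes\<close> demands.\<close>

definition block_perm ::
    "nat \<Rightarrow> nat \<Rightarrow> (nat \<Rightarrow> nat) \<Rightarrow> (nat \<Rightarrow> nat \<Rightarrow> nat) \<Rightarrow> (nat \<Rightarrow> nat \<Rightarrow> nat) \<Rightarrow> nat \<Rightarrow> nat"
  where "block_perm n l d \<phi> q y =
    (if y \<in> {1..n}
     then case inv_into (SIGMA i:{1..l}. {1..d i}) (\<lambda>(i, x). \<phi> i x) y of (i, x) \<Rightarrow> \<phi> i (q i x)
     else y)"

context
  fixes n l :: nat and d :: "nat \<Rightarrow> nat" and \<phi> :: "nat \<Rightarrow> nat \<Rightarrow> nat"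
  assumes labelling: "block_labelling n l d \<phi>"
begin

lemma block_labelling_mem:
  assumes "i \<in> {1..l}" "x \<in> {1..d i}"
  shows "\<phi> i x \<in> {1..n}"
  using labelling assms unfolding block_labelling_def bij_betw_def by force

lemma block_labelling_cases:
  assumes "y \<in> {1..n}"
  obtains i x where "i \<in> {1..l}" "x \<in> {1..d i}" "y = \<phi> i x"
proof -
  have "y \<in> (\<lambda>(i, x). \<phi> i x) ` (SIGMA i:{1..l}. {1..d i})"
    using labelling assms by (simp add: block_labelling_def bij_betw_def)
  with that show thesis by auto
qed

lemma block_labelling_inj:
  assumes "\<phi> i x = \<phi> i y" "i \<in> {1..l}" "x \<in> {1..d i}" "y \<in> {1..d i}"
  shows "x = y"
proof -
  have "inj_on (\<lambda>(i, x). \<phi> i x) (SIGMA i:{1..l}. {1..d i})"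
    using labelling by (simp add: block_labelling_def bij_betw_def)
  from inj_onD[OF this, of "(i, x)" "(i, y)"] assms show ?thesis by simp
qed

lemma block_perm_apply:
  assumes "i \<in> {1..l}" "x \<in> {1..d i}"
  shows "block_perm n l d \<phi> q (\<phi> i x) = \<phi> i (q i x)"
proof -
  have "inv_into (SIGMA i:{1..l}. {1..d i}) (\<lambda>(i, x). \<phi> i x) (\<phi> i x) = (i, x)"
    using labelling assms inv_into_f_f[of "\<lambda>(i, x). \<phi> i x" "SIGMA i:{1..l}. {1..d i}" "(i, x)"]
    by (simp add: block_labelling_def bij_betw_def)
  then show ?thesis
    using block_labelling_mem[OF assms] by (simp add: block_perm_def)
qed

lemma block_perm_permutes:
  assumes q: "\<And>i. i \<in> {1..l} \<Longrightarrow> q i permutes {1..d i}"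
  shows "block_perm n l d \<phi> q permutes {1..n}"
proof (rule bij_imp_permutes)
  \<comment> \<open>Only surjectivity is shown by hand; injectivity follows by finiteness.\<close>
  have "{1..n} \<subseteq> block_perm n l d \<phi> q ` {1..n}"
  proof
    fix y assume "y \<in> {1..n}"
    then obtain i x where ix: "i \<in> {1..l}" "x \<in> {1..d i}" "y = \<phi> i x"
      by (rule block_labelling_cases)
    have "x \<in> q i ` {1..d i}"
      using permutes_image[OF q[OF ix(1)]] ix(2) by simp
    then obtain x' where x': "x' \<in> {1..d i}" "x = q i x'"
      by (rule imageE)
    have "y = block_perm n l d \<phi> q (\<phi> i x')"
      using ix x' by (simp only: block_perm_apply)
    with block_labelling_mem[OF ix(1) x'(1)] show "y \<in> block_perm n l d \<phi> q ` {1..n}"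
      by (rule image_eqI[rotated])
  qed
  moreover have "block_perm n l d \<phi> q y \<in> {1..n}" if "y \<in> {1..n}" for y
  proof -
    from that obtain i x where ix: "i \<in> {1..l}" "x \<in> {1..d i}" "y = \<phi> i x"
      by (rule block_labelling_cases)
    then have "q i x \<in> {1..d i}"
      using permutes_in_image[OF q] by blast
    with ix show ?thesis
      using block_labelling_mem by (simp only: block_perm_apply)
  qed
  then have "block_perm n l d \<phi> q ` {1..n} \<subseteq> {1..n}" by blast
  ultimately have "block_perm n l d \<phi> q ` {1..n} = {1..n}" by blast
  then show "bij_betw (block_perm n l d \<phi> q) {1..n} {1..n}"
    unfolding bij_betw_def using eq_card_imp_inj_on by (metis finite_atLeastAtMost)
qed (auto simp: block_perm_def)

text \<open>The labelled points exhaust \<open>{1..n}\<close> and both maps fix everything else.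
  This recognises elements of the direct product, and composites of block permutations, as block
  permutations.\<close>

lemma block_perm_unique:
  assumes p: "p permutes {1..n}" and q: "\<And>i. i \<in> {1..l} \<Longrightarrow> q i permutes {1..d i}"
    and eq: "\<And>i x. i \<in> {1..l} \<Longrightarrow> x \<in> {1..d i} \<Longrightarrow> p (\<phi> i x) = \<phi> i (q i x)"
  shows "p = block_perm n l d \<phi> q"
proof
  fix y show "p y = block_perm n l d \<phi> q y"
  proof (cases "y \<in> {1..n}")
    case True
    then show ?thesis
      by (metis block_labelling_cases block_perm_apply eq)
  next
    case False
    with permutes_not_in[OF p False] show ?thesis
      by (auto simp: block_perm_def)
  qed
qed

lemma perm_direct_product_eq_image:
  assumes Q: "\<And>i q. i \<in> {1..l} \<Longrightarrow> q \<in> Q i \<Longrightarrow> q permutes {1..d i}"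
  shows "perm_direct_product n l d \<phi> Q = block_perm n l d \<phi> ` (\<Pi>\<^sub>E i\<in>{1..l}. Q i)"
proof (intro subset_antisym subsetI)
  fix p assume "p \<in> perm_direct_product n l d \<phi> Q"
  then obtain q where p: "p permutes {1..n}" and q: "q \<in> (\<Pi>\<^sub>E i\<in>{1..l}. Q i)"
    and eq: "\<forall>i\<in>{1..l}. \<forall>x\<in>{1..d i}. p (\<phi> i x) = \<phi> i (q i x)"
    unfolding perm_direct_product_def by blast
  have "p = block_perm n l d \<phi> q"
  proof (rule block_perm_unique[OF p])
    show "q i permutes {1..d i}" if "i \<in> {1..l}" for i
      using Q[OF that PiE_mem[OF q that]] .
  qed (use eq in blast)
  with q show "p \<in> block_perm n l d \<phi> ` (\<Pi>\<^sub>E i\<in>{1..l}. Q i)" by blast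
next
  fix p assume "p \<in> block_perm n l d \<phi> ` (\<Pi>\<^sub>E i\<in>{1..l}. Q i)"
  then obtain q where q: "q \<in> (\<Pi>\<^sub>E i\<in>{1..l}. Q i)" "p = block_perm n l d \<phi> q" by blast
  then have "p permutes {1..n}"
    using block_perm_permutes[of q] Q PiE_mem[OF q(1)] by blast
  with q show "p \<in> perm_direct_product n l d \<phi> Q"
    unfolding perm_direct_product_def using block_perm_apply by blast
qed

text \<open>Injectivity of \<open>\<phi> i\<close> on its block recovers \<open>q i\<close> on
  \<open>{1..d i}\<close>. Elsewhere \<open>q i\<close> is the identity, and extensionality of the
  tuple settles indices outside \<open>{1..l}\<close>.\<close>

lemma inj_on_block_perm:
  assumes Q: "\<And>i q. i \<in> {1..l} \<Longrightarrow> q \<in> Q i \<Longrightarrow> q permutes {1..d i}"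
  shows "inj_on (block_perm n l d \<phi>) (\<Pi>\<^sub>E i\<in>{1..l}. Q i)"
proof (rule inj_onI)
  fix q r assume q: "q \<in> (\<Pi>\<^sub>E i\<in>{1..l}. Q i)" and r: "r \<in> (\<Pi>\<^sub>E i\<in>{1..l}. Q i)"
    and eq: "block_perm n l d \<phi> q = block_perm n l d \<phi> r"
  show "q = r"
  proof (rule PiE_ext[OF q r])
    fix i assume i: "i \<in> {1..l}"
    have perm: "q i permutes {1..d i}" "r i permutes {1..d i}"
      using Q i q r by (meson PiE_mem)+
    show "q i = r i"
    proof
      fix x show "q i x = r i x"
      proof (cases "x \<in> {1..d i}")
        case True
        with eq i have "\<phi> i (q i x) = \<phi> i (r i x)"
          by (metis block_perm_apply)
        with True i perm show ?thesis
          by (metis block_labelling_inj permutes_in_image)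
      next
        case False
        with perm show ?thesis
          by (metis permutes_not_in)
      qed
    qed
  qed
qed

lemma block_perm_hom:
  assumes Q: "\<And>i. i \<in> {1..l} \<Longrightarrow> subgroup (Q i) (sym_group (d i))"
  shows "block_perm n l d \<phi> \<in>
    hom (product_group {1..l} (\<lambda>i. sym_group (d i)\<lparr>carrier := Q i\<rparr>)) (sym_group n)"
proof (rule homI)
  have perm: "q i permutes {1..d i}" if "q \<in> (\<Pi>\<^sub>E i\<in>{1..l}. Q i)" "i \<in> {1..l}" for q i
    using Q[OF that(2)] that by (meson PiE_mem subgroup.mem_carrier sym_group_carrier)
  let ?G = "product_group {1..l} (\<lambda>i. sym_group (d i)\<lparr>carrier := Q i\<rparr>)"
  show "block_perm n l d \<phi> q \<in> carrier (sym_group n)" if "q \<in> carrier ?G" for q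
    using that perm[of q] block_perm_permutes[of q] by (simp add: sym_group_carrier)
  fix q r assume qr: "q \<in> carrier ?G" "r \<in> carrier ?G"
  have "block_perm n l d \<phi> q \<circ> block_perm n l d \<phi> r
      = block_perm n l d \<phi> (\<lambda>i\<in>{1..l}. q i \<circ> r i)"
  proof (rule block_perm_unique)
    show "block_perm n l d \<phi> q \<circ> block_perm n l d \<phi> r permutes {1..n}"
      using qr perm by (intro permutes_compose block_perm_permutes) auto
    show "(\<lambda>i\<in>{1..l}. q i \<circ> r i) i permutes {1..d i}" if "i \<in> {1..l}" for i
      using that qr perm by (simp add: permutes_compose)
    fix i x assume ix: "i \<in> {1..l}" "x \<in> {1..d i}"
    \<comment> \<open>The position stays within block \<open>i\<close>, so
      \<open>block_perm_apply\<close> can be used a second time, for \<open>q\<close>.\<close>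
    have "r i x \<in> {1..d i}"
      using permutes_in_image[OF perm[of r i]] qr(2) ix by simp
    with ix show "(block_perm n l d \<phi> q \<circ> block_perm n l d \<phi> r) (\<phi> i x)
        = \<phi> i ((\<lambda>i\<in>{1..l}. q i \<circ> r i) i x)"
      by (simp add: block_perm_apply)
  qed
  then show "block_perm n l d \<phi> (q \<otimes>\<^bsub>?G\<^esub> r)
      = block_perm n l d \<phi> q \<otimes>\<^bsub>sym_group n\<^esub> block_perm n l d \<phi> r"
    by (simp add: sym_group_mult)
qed

text \<open>The permutation group on \<open>{1..n}\<close> is the image of the abstract product
  under the injective homomorphism \<open>block_perm\<close>.\<close>

lemma perm_direct_product_iso:
  assumes Q: "\<And>i. i \<in> {1..l} \<Longrightarrow> subgroup (Q i) (sym_group (d i))"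
  shows "subgroup (perm_direct_product n l d \<phi> Q) (sym_group n)"
    and "product_group {1..l} (\<lambda>i. sym_group (d i)\<lparr>carrier := Q i\<rparr>)
           \<cong> sym_group n\<lparr>carrier := perm_direct_product n l d \<phi> Q\<rparr>"
proof -
  let ?G = "product_group {1..l} (\<lambda>i. sym_group (d i)\<lparr>carrier := Q i\<rparr>)"
  have perm: "q permutes {1..d i}" if "q \<in> Q i" "i \<in> {1..l}" for q i
    using Q[OF that(2)] that by (meson subgroup.mem_carrier sym_group_carrier)
  have image: "perm_direct_product n l d \<phi> Q = block_perm n l d \<phi> ` carrier ?G"
    using perm_direct_product_eq_image[of Q] perm by simp
  have inj: "inj_on (block_perm n l d \<phi>) (carrier ?G)"
    using inj_on_block_perm[of Q] perm by simp
  interpret group_hom ?G "sym_group n" "block_perm n l d \<phi>"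
    using Q block_perm_hom[of Q]
    by (auto simp: group_hom_def group_hom_axioms_def sym_group_is_group
        intro!: product_group group.subgroup_imp_group)
  show "subgroup (perm_direct_product n l d \<phi> Q) (sym_group n)"
    unfolding image by (rule img_is_subgroup)
  have "block_perm n l d \<phi> \<in> iso ?G (sym_group n\<lparr>carrier := perm_direct_product n l d \<phi> Q\<rparr>)"
    using inj homh unfolding image by (auto simp: iso_def hom_def bij_betw_def)
  then show "?G \<cong> sym_group n\<lparr>carrier := perm_direct_product n l d \<phi> Q\<rparr>"
    by (rule is_isoI)
qed

end

lemma card_perm_direct_product:
  assumes "block_labelling n l d \<phi>"
    and "\<And>i. i \<in> {1..l} \<Longrightarrow> subgroup (Q i) (sym_group (d i))"
  shows "card (perm_direct_product n l d \<phi> Q) = (\<Prod>i = 1..l. card (Q i))"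
  using iso_same_card[OF perm_direct_product_iso(2)[OF assms]] by (simp add: card_PiE)

text \<open>The order is a product of powers of \<open>p\<close>; by the last assumption the
  exponents add up to the valuation of \<open>fact n\<close>, the order of the symmetric
  group.\<close>

lemma sylow_perm_direct_product:
  assumes "block_labelling n l d \<phi>"
    and "\<And>i. i \<in> {1..l} \<Longrightarrow> sylow_subgroup p (sym_group (d i)) (Q i)"
    and "multiplicity p (fact n :: nat) = (\<Sum>i = 1..l. multiplicity p (fact (d i) :: nat))"
  shows "sylow_subgroup p (sym_group n) (perm_direct_product n l d \<phi> Q)"
  using assms perm_direct_product_iso(1)[of n l d \<phi> Q] card_perm_direct_product[of n l d \<phi> Q]
  by (simp add: sylow_subgroup_def order_def sym_group_card_carrier power_sum)

section \<open>Even permutations in a Sylow 2-subgroup\<close>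

lemma finite_sym_group: "finite (carrier (sym_group n))"
  using finite_permutations[of "{1..n}"] by (simp add: sym_group_def)

lemma finite_alt_group: "finite (carrier (alt_group n))"
  using finite_subset[OF subgroup.subset[OF alt_group_is_subgroup] finite_sym_group] .

lemma subgroup_alt_group_iff:
  "subgroup H (alt_group n) \<longleftrightarrow> subgroup H (sym_group n) \<and> (\<forall>h\<in>H. evenperm h)"
proof -
  \<comment> \<open>In this form the general facts on subgroups of subgroups apply to the
    alternating group.\<close>
  have alt: "alt_group n = sym_group n\<lparr>carrier := carrier (alt_group n)\<rparr>"
    by (simp add: alt_group_def)
  show ?thesis
  proof safe
    assume "subgroup H (alt_group n)"
    then show "subgroup H (sym_group n)"
      using group.incl_subgroup[OF sym_group_is_group alt_group_is_subgroup] alt by metis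
  next
    fix h assume "subgroup H (alt_group n)" "h \<in> H"
    then show "evenperm h"
      by (meson alt_group_carrier subgroup.mem_carrier)
  next
    assume H: "subgroup H (sym_group n)" "\<forall>h\<in>H. evenperm h"
    then have "H \<subseteq> carrier (alt_group n)"
      using subgroup.mem_carrier[OF H(1)] by (auto simp: alt_group_carrier sym_group_carrier)
    then show "subgroup H (alt_group n)"
      using group.subgroup_incl[OF sym_group_is_group H(1) alt_group_is_subgroup] alt by metis
  qed
qed

lemma subgroup_Par:
  assumes "subgroup H (sym_group n)"
  shows "subgroup (Par H) (alt_group n)"
proof -
  have "Par H = H \<inter> carrier (alt_group n)"
    using subgroup.mem_carrier[OF assms] by (auto simp: Par_def alt_group_carrier sym_group_carrier)
  then have "subgroup (Par H) (sym_group n)"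
    using group.subgroups_Inter_pair[OF sym_group_is_group assms alt_group_is_subgroup] by simp
  then show ?thesis
    by (simp add: subgroup_alt_group_iff Par_def)
qed

text \<open>Composition with the odd permutation \<open>s\<close> exchanges the even and the odd
  elements of \<open>H\<close>.\<close>

lemma card_Par:
  assumes H: "subgroup H (sym_group n)" and odd: "s \<in> H" "\<not> evenperm s"
  shows "card H = 2 * card (Par H)"
proof -
  interpret subgroup H "sym_group n" by (rule H)
  have fin: "finite H"
    using finite_subset[OF subset finite_sym_group] .
  have perm: "permutation h" if "h \<in> H" for h
    using that mem_carrier sym_group_carrier' by blast
  have closed: "h \<circ> h' \<in> H" if "h \<in> H" "h' \<in> H" for h h'
    using m_closed[OF that] by (simp add: sym_group_mult)
  have s': "inv' s \<in> H" "bij s"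
    using m_inv_closed[OF odd(1)] odd(1) mem_carrier permutation_bijective[OF perm]
    by auto
  have "bij_betw (\<lambda>h. s \<circ> h) (Par H) (H - Par H)"
  proof (rule bij_betw_byWitness[where f' = "\<lambda>h. inv' s \<circ> h"])
    show "(\<lambda>h. s \<circ> h) ` Par H \<subseteq> H - Par H"
      using odd closed by (auto simp: Par_def evenperm_comp perm)
    show "(\<lambda>h. inv' s \<circ> h) ` (H - Par H) \<subseteq> Par H"
      using odd closed s' by (auto simp: Par_def evenperm_comp evenperm_inv perm)
  qed (use s' in \<open>auto simp: fun_eq_iff bij_is_inj bij_is_surj surj_f_inv_f\<close>)
  then have "card (Par H) = card (H - Par H)"
    by (rule bij_betw_same_card)
  moreover have "Par H \<subseteq> H"
    by (auto simp: Par_def)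
  ultimately show ?thesis
    using fin card_Diff_subset[of "Par H" H] card_mono[of H "Par H"]
    by (metis add_diff_inverse_nat finite_subset mult_2 not_le)
qed

lemma multiplicity_order_sym_alt:
  assumes "2 \<le> n"
  shows "multiplicity 2 (order (sym_group n)) = Suc (multiplicity 2 (order (alt_group n)))"
proof -
  have eq: "order (sym_group n) = 2 * order (alt_group n)"
    using alt_group_card_carrier[OF assms] by (simp add: order_def sym_group_card_carrier)
  moreover have "order (alt_group n) > 0"
    by (simp add: monoid.order_gt_0_iff_finite group.is_monoid alt_group_is_group finite_alt_group)
  ultimately show ?thesis
    by (simp add: multiplicity_times_same)
qed

text \<open>If \<open>P\<close> were contained in the alternating group, its order would divide that
  of \<open>alt_group n\<close> by Lagrange, yet it has one more factor 2 than that order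
  allows.\<close>

lemma sylow_has_odd:
  assumes n: "2 \<le> n" and P: "sylow_subgroup 2 (sym_group n) P"
  shows "\<exists>s\<in>P. \<not> evenperm s"
proof (rule ccontr)
  assume "\<not> ?thesis"
  then have "subgroup P (alt_group n)"
    using P by (simp add: subgroup_alt_group_iff sylow_subgroup_def)
  then have "card P dvd order (alt_group n)"
    using group.lagrange[OF alt_group_is_group] by (metis dvd_triv_right)
  then have "2 ^ Suc (multiplicity 2 (order (alt_group n))) dvd order (alt_group n)"
    using P multiplicity_order_sym_alt[OF n] by (simp add: sylow_subgroup_def)
  moreover have "order (alt_group n) > 0"
    by (simp add: monoid.order_gt_0_iff_finite group.is_monoid alt_group_is_group finite_alt_group)
  ultimately show False
    using multiplicity_geI[of "order (alt_group n)" 2 "Suc (multiplicity 2 (order (alt_group n)))"]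
    by simp
qed

lemma sylow_Par:
  assumes P: "sylow_subgroup 2 (sym_group n) P"
  shows "sylow_subgroup 2 (alt_group n) (Par P)"
proof -
  have PG: "subgroup P (sym_group n)"
    using P by (simp add: sylow_subgroup_def)
  have "card (Par P) = 2 ^ multiplicity 2 (order (alt_group n))"
  proof (cases "2 \<le> n")
    case True
    then show ?thesis
      using sylow_has_odd[OF True P] card_Par[OF PG] P multiplicity_order_sym_alt[OF True]
      by (auto simp: sylow_subgroup_def)
  next
    case False
    \<comment> \<open>For \<open>n \<le> 1\<close> no odd permutation exists, but both groups are
      trivial and so is \<open>Par P\<close>.\<close>
    then have "{1..n} = {} \<or> {1..n} = {1}"
      by (cases n) auto
    then have carr: "carrier (sym_group n) = {id}"
      by (auto simp: sym_group_def)
    then have alt: "carrier (alt_group n) = {id}"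
      by (auto simp: alt_group_def sym_group_def)
    have "Par P = {id}"
      using subgroup.subset[OF subgroup_Par[OF PG]] subgroup.one_closed[OF subgroup_Par[OF PG]] alt
      by (auto simp: alt_group_one)
    with alt show ?thesis
      by (simp add: order_def)
  qed
  with subgroup_Par[OF PG] show ?thesis
    by (simp add: sylow_subgroup_def)
qed

text \<open>Bridges conjugacy inside \<open>alt_group n\<close> and \<open>boxtimes\<close>, which
  is built on \<open>sym_group n\<close>.\<close>

lemma alt_group_with_carrier: "alt_group n\<lparr>carrier := H\<rparr> = sym_group n\<lparr>carrier := H\<rparr>"
  by (simp add: alt_group_def)

text \<open>All Sylow subgroups and the labelling are arbitrary. The index is stated for
  \<open>R \<subseteq> P\<close>; the two existence claims show that every \<open>R\<close> and
  every \<open>P\<close> occurs in such a pair. For \<open>n = 1\<close> both groups are trivial and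
  the index is 1, whence \<open>2 \<le> n\<close>.\<close>

theorem mainTheorem4:
  fixes n l :: nat
    and k :: "nat \<Rightarrow> nat"
    and P R :: "(nat \<Rightarrow> nat) set"
    and Q :: "nat \<Rightarrow> (nat \<Rightarrow> nat) set"
    and \<phi> :: "nat \<Rightarrow> nat \<Rightarrow> nat"
  assumes l: "1 \<le> l"
    and k_decreasing: "\<And>i. i \<in> {2..l} \<Longrightarrow> k i < k (i - 1)"
    and n: "n = (\<Sum>i = 1..l. 2 ^ k i)"
    and P: "sylow_subgroup 2 (sym_group n) P"
    and R: "sylow_subgroup 2 (alt_group n) R"
    and Q: "\<And>i. i \<in> {1..l} \<Longrightarrow> sylow_subgroup 2 (sym_group (2 ^ k i)) (Q i)"
    and \<phi>: "block_labelling n l (\<lambda>i. 2 ^ k i) \<phi>"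
  shows "sym_group n\<lparr>carrier := P\<rparr>
           \<cong> product_group {1..l} (\<lambda>i. sym_group (2 ^ k i)\<lparr>carrier := Q i\<rparr>)
    \<and> (\<exists>P'. sylow_subgroup 2 (sym_group n) P' \<and> R \<subseteq> P')
    \<and> (\<exists>R'. sylow_subgroup 2 (alt_group n) R' \<and> R' \<subseteq> P)
    \<and> (2 \<le> n \<longrightarrow> R \<subseteq> P \<longrightarrow> card (rcosets\<^bsub>sym_group n\<lparr>carrier := P\<rparr>\<^esub> R) = 2)
    \<and> alt_group n\<lparr>carrier := R\<rparr> \<cong> boxtimes n l (\<lambda>i. 2 ^ k i) \<phi> Q"
proof (intro conjI impI)
  let ?D = "perm_direct_product n l (\<lambda>i. 2 ^ k i) \<phi> Q"
  have D: "sylow_subgroup 2 (sym_group n) ?D"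
    using \<phi> Q multiplicity_fact_sum_powers[of l k] k_decreasing l
    by (intro sylow_perm_direct_product) (simp_all add: n)
  have QG: "subgroup (Q i) (sym_group (2 ^ k i))" if "i \<in> {1..l}" for i
    using Q[OF that] by (simp add: sylow_subgroup_def)
  have "product_group {1..l} (\<lambda>i. sym_group (2 ^ k i)\<lparr>carrier := Q i\<rparr>)
      \<cong> sym_group n\<lparr>carrier := ?D\<rparr>"
    using perm_direct_product_iso(2)[OF \<phi> QG] .
  \<comment> \<open>Reversing the isomorphism by \<open>group.iso_sym\<close> requires its source to
    be a group.\<close>
  moreover have "group (product_group {1..l} (\<lambda>i. sym_group (2 ^ k i)\<lparr>carrier := Q i\<rparr>))"
    using QG by (intro product_group group.subgroup_imp_group sym_group_is_group)
  ultimately show "sym_group n\<lparr>carrier := P\<rparr>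
      \<cong> product_group {1..l} (\<lambda>i. sym_group (2 ^ k i)\<lparr>carrier := Q i\<rparr>)"
    using group.sylow_subgroups_iso[OF sym_group_is_group finite_sym_group two_is_prime_nat P D]
      group.iso_sym iso_trans by blast
  have RG: "subgroup R (sym_group n)" "card R = 2 ^ multiplicity 2 (order (alt_group n))"
    using R by (auto simp: sylow_subgroup_def subgroup_alt_group_iff)
  show "\<exists>P'. sylow_subgroup 2 (sym_group n) P' \<and> R \<subseteq> P'"
    using group.p_subgroup_in_sylow[OF sym_group_is_group finite_sym_group two_is_prime_nat RG P] .
  \<comment> \<open>The witness is \<open>Par P\<close>.\<close>
  show "\<exists>R'. sylow_subgroup 2 (alt_group n) R' \<and> R' \<subseteq> P"
    using sylow_Par[OF P] by (auto simp: Par_def)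
  show "card (rcosets\<^bsub>sym_group n\<lparr>carrier := P\<rparr>\<^esub> R) = 2" if "2 \<le> n" "R \<subseteq> P"
  proof -
    have PG: "subgroup P (sym_group n)"
      using P by (simp add: sylow_subgroup_def)
    interpret PG: group "sym_group n\<lparr>carrier := P\<rparr>"
      using group.subgroup_imp_group[OF sym_group_is_group PG] .
    have "card (rcosets\<^bsub>sym_group n\<lparr>carrier := P\<rparr>\<^esub> R) * card R = card P"
      using PG.lagrange[OF group.subgroup_incl[OF sym_group_is_group RG(1) PG that(2)]]
      by (simp add: order_def)
    moreover have "card P = 2 * card R"
      using P RG(2) multiplicity_order_sym_alt[OF that(1)] by (simp add: sylow_subgroup_def)
    ultimately show ?thesis
      using RG(2) by simp
  qed
  \<comment> \<open>The carrier of \<open>boxtimes\<close> is \<open>Par ?D\<close>, itself a Sylow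
    2-subgroup of the alternating group, so \<open>R\<close> is isomorphic to it by conjugation
    there.\<close>
  show "alt_group n\<lparr>carrier := R\<rparr> \<cong> boxtimes n l (\<lambda>i. 2 ^ k i) \<phi> Q"
    using group.sylow_subgroups_iso[OF alt_group_is_group finite_alt_group two_is_prime_nat R
        sylow_Par[OF D]]
    by (simp add: boxtimes_def alt_group_with_carrier)
qed

end
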